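(* Let $n\ge1$ be an integer and let $W(3,n)$ be the weaving link, i.e. the closure of the 3-braid $(\sigma_1\sigma_2^{-1})^n$. If $z\in\mathbb{C}$ is a zero of the Alexander polynomial $\Delta_{W(3,n)}(t)$, then $\operatorname{Re}(z)>-1$. Moreover, if $z$ is a non-real zero, then $|z|=1$.
   Context: $B_3=\langle\sigma_1,\sigma_2\mid \sigma_1\sigma_2\sigma_1=\sigma_2\sigma_1\sigma_2\rangle$ is the braid group on 3 strands. The (reduced) Burau representation $\psi_t:B_3\to GL(2,\mathbb{Z}[t,t^{-1}])$ is given by $$\psi_t(\sigma_1)=\begin{pmatrix}-t&1\\0&1\end{pmatrix},\qquad \psi_t(\sigma_2)=\begin{pmatrix}1&0\\t&-t\end{pmatrix}.$$ For a 3-braid $b$ with exponent sum $e_b$, the Alexander polynomial of the closure $L=\hat b$ is, up to multiplication by a unit of $\mathbb{Z}[t,t^{-1}]$, $$\Delta_L(t)=(-1/\sqrt t)^{e_b-2}\,\frac{1-t}{1-t^3}\,\det\bigl(I_2-\psi_t(b)\bigr).$$ Zeroes are (nonzero) complex zeroes, which do not depend on the choice of unit. *)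

theory Defs
  imports "HOL-Analysis.Analysis" "HOL-Computational_Algebra.Polynomial_Factorial"
begin

section \<open>The braid group on three strands\<close>

datatype gen = S1 | S2

text \<open>A letter \<open>(g, True)\<close> stands for the generator \<open>g\<close>, and \<open>(g, False)\<close> for its inverse.\<close>

type_synonym braid_word = "(gen \<times> bool) list"

inductive braid_eq :: "braid_word \<Rightarrow> braid_word \<Rightarrow> bool" where
  refl: "braid_eq u u"
| sym: "braid_eq u v \<Longrightarrow> braid_eq v u"
| trans: "braid_eq u v \<Longrightarrow> braid_eq v w \<Longrightarrow> braid_eq u w"
| cong: "braid_eq u u' \<Longrightarrow> braid_eq v v' \<Longrightarrow> braid_eq (u @ v) (u' @ v')"
| cancel: "braid_eq [(g, e), (g, \<not> e)] []"
| braid: "braid_eq [(S1, True), (S2, True), (S1, True)] [(S2, True), (S1, True), (S2, True)]"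

lemma equivp_braid_eq: "equivp braid_eq"
  by (rule equivpI) (auto simp: reflp_def symp_def transp_def
      intro: braid_eq.refl braid_eq.sym braid_eq.trans)

quotient_type braid3 = braid_word / braid_eq
  by (rule equivp_braid_eq)

definition inv_word :: "braid_word \<Rightarrow> braid_word" where
  "inv_word w = rev (map (\<lambda>(g, e). (g, \<not> e)) w)"

lemma braid_eq_inv_right: "braid_eq (w @ inv_word w) []"
proof (induction w)
  case Nil
  show ?case by (simp add: inv_word_def braid_eq.refl)
next
  case (Cons a w)
  obtain g e where a: "a = (g, e)" by (cases a)
  have "braid_eq ([a] @ ((w @ inv_word w) @ [(g, \<not> e)])) ([a] @ ([] @ [(g, \<not> e)]))"
    by (intro braid_eq.cong braid_eq.refl Cons.IH)
  then show ?case
    using braid_eq.cancel[of g e] by (auto simp: a inv_word_def intro: braid_eq.trans)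
qed

lemma inv_word_inv_word: "inv_word (inv_word w) = w"
  by (induction w) (auto simp: inv_word_def)

lemma braid_eq_inv_left: "braid_eq (inv_word w @ w) []"
  using braid_eq_inv_right[of "inv_word w"] by (simp add: inv_word_inv_word)

lemma braid_eq_inv_word:
  assumes "braid_eq u v" shows "braid_eq (inv_word u) (inv_word v)"
proof -
  have "braid_eq (inv_word u @ []) (inv_word u @ (v @ inv_word v))"
    by (intro braid_eq.cong braid_eq.refl braid_eq.sym[OF braid_eq_inv_right])
  moreover have "braid_eq (inv_word u @ (v @ inv_word v)) (inv_word u @ (u @ inv_word v))"
    by (intro braid_eq.cong braid_eq.refl braid_eq.sym[OF assms])
  moreover have "braid_eq ((inv_word u @ u) @ inv_word v) ([] @ inv_word v)"
    by (intro braid_eq.cong braid_eq.refl braid_eq_inv_left)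
  ultimately show ?thesis by (auto intro: braid_eq.trans)
qed

instantiation braid3 :: "{monoid_mult, inverse}"
begin

lift_definition one_braid3 :: braid3 is "[]" .

lift_definition times_braid3 :: "braid3 \<Rightarrow> braid3 \<Rightarrow> braid3" is append
  by (rule braid_eq.cong)

lift_definition inverse_braid3 :: "braid3 \<Rightarrow> braid3" is inv_word
  by (rule braid_eq_inv_word)

definition divide_braid3 :: "braid3 \<Rightarrow> braid3 \<Rightarrow> braid3" where
  "divide_braid3 a b = a * inverse b"

instance
  by standard (transfer; simp add: braid_eq.refl)+

end

lift_definition \<sigma>\<^sub>1 :: braid3 is "[(S1, True)]" .
lift_definition \<sigma>\<^sub>2 :: braid3 is "[(S2, True)]" .

lemma braid3_left_inverse: "inverse b * b = (1 :: braid3)"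
  by transfer (rule braid_eq_inv_left)

lemma braid3_right_inverse: "b * inverse b = (1 :: braid3)"
  by transfer (rule braid_eq_inv_right)

lemma braid3_relation: "\<sigma>\<^sub>1 * \<sigma>\<^sub>2 * \<sigma>\<^sub>1 = \<sigma>\<^sub>2 * \<sigma>\<^sub>1 * \<sigma>\<^sub>2"
  by transfer (simp add: braid_eq.braid)

definition weaving_braid3 :: "nat \<Rightarrow> braid3" where
  "weaving_braid3 n = (\<sigma>\<^sub>1 * inverse \<sigma>\<^sub>2) ^ n"

section \<open>Exponent sum and Burau representation\<close>

definition exp_sum_word :: "braid_word \<Rightarrow> int" where
  "exp_sum_word w = (\<Sum>(g, e)\<leftarrow>w. if e then 1 else - 1)"

lift_definition exponent_sum :: "braid3 \<Rightarrow> int" is exp_sum_word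
  subgoal for u v by (induction rule: braid_eq.induct) (auto simp: exp_sum_word_def)
  done

text \<open>
  The ring of Laurent polynomials in \<open>\<surd>t\<close> sits inside the field of fractions of the polynomial ring
  over the integers in an indeterminate \<open>\<surd>t\<close>, and all formulas live in that field.
\<close>

definition sqrt_t :: "int poly fract" where "sqrt_t = to_fract [:0, 1:]"

definition t :: "int poly fract" where "t = sqrt_t ^ 2"

lemma sqrt_t_neq_0: "sqrt_t \<noteq> 0"
  by (simp add: sqrt_t_def)

lemma t_neq_0: "t \<noteq> 0"
  by (simp add: t_def sqrt_t_neq_0)

fun burau_gen :: "gen \<Rightarrow> int poly fract ^ 2 ^ 2" where
  "burau_gen S1 = vector [vector [- t, 1], vector [0, 1]]"
| "burau_gen S2 = vector [vector [1, 0], vector [t, - t]]"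

fun burau_letter :: "gen \<times> bool \<Rightarrow> int poly fract ^ 2 ^ 2" where
  "burau_letter (g, e) = (if e then burau_gen g else matrix_inv (burau_gen g))"

definition burau_word :: "braid_word \<Rightarrow> int poly fract ^ 2 ^ 2" where
  "burau_word w = foldr (\<lambda>a M. burau_letter a ** M) w (mat 1)"

lemma invertible_burau_gen: "invertible (burau_gen g)"
  by (cases g) (simp_all add: invertible_det_nz det_2 t_neq_0)

lemma burau_gen_inv:
  "burau_gen g ** matrix_inv (burau_gen g) = mat 1"
  "matrix_inv (burau_gen g) ** burau_gen g = mat 1"
  using someI_ex[OF invertible_burau_gen[of g, unfolded invertible_def]]
  by (auto simp: matrix_inv_def)

lemma burau_word_append: "burau_word (u @ v) = burau_word u ** burau_word v"
  by (induction u) (auto simp: burau_word_def matrix_mul_assoc)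

lift_definition burau :: "braid3 \<Rightarrow> int poly fract ^ 2 ^ 2" is burau_word
  subgoal for u v
  proof (induction rule: braid_eq.induct)
    case (cancel g e)
    show ?case by (simp add: burau_word_def burau_gen_inv)
  next
    case braid
    show ?case
      by (simp add: burau_word_def matrix_matrix_mult_def vec_eq_iff forall_2 sum_2 mat_def
          algebra_simps)
  qed (auto simp: burau_word_append)
  done

lemma burau_one: "burau 1 = mat 1"
  by transfer (simp add: burau_word_def)

lemma burau_mult: "burau (a * b) = burau a ** burau b"
  by transfer (rule burau_word_append)

lemma burau_sigma1: "burau \<sigma>\<^sub>1 = vector [vector [- t, 1], vector [0, 1]]"
  by transfer (simp add: burau_word_def)

lemma burau_sigma2: "burau \<sigma>\<^sub>2 = vector [vector [1, 0], vector [t, - t]]"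
  by transfer (simp add: burau_word_def)

section \<open>The Alexander polynomial of a closed 3-braid\<close>

text \<open>
  Laurent polynomials with integer coefficients in \<open>x\<close>; used for \<open>x = t\<close> and for \<open>x = \<surd>t\<close>.
\<close>

definition laurent_polys :: "int poly fract \<Rightarrow> int poly fract set" where
  "laurent_polys x = {poly (map_poly of_int p) x / x ^ k | (p :: int poly) k. True}"

definition laurent_unit :: "int poly fract \<Rightarrow> bool" where
  "laurent_unit u \<longleftrightarrow> u \<in> laurent_polys t \<and> (\<exists>v \<in> laurent_polys t. u * v = 1)"

definition alexander_formula :: "braid3 \<Rightarrow> int poly fract" where
  "alexander_formula b =
     (- 1 / sqrt_t) powi (exponent_sum b - 2) * ((1 - t) / (1 - t ^ 3)) * det (mat 1 - burau b)"

text \<open>\<open>\<Delta>\<close> is an Alexander polynomial of the closure of the braid \<open>b\<close>.\<close>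

definition alexander_polynomial_of_closure :: "braid3 \<Rightarrow> int poly fract \<Rightarrow> bool" where
  "alexander_polynomial_of_closure b \<Delta> \<longleftrightarrow> (\<exists>u. laurent_unit u \<and> \<Delta> = u * alexander_formula b)"

text \<open>
  \<open>z\<close> is a nonzero complex zero of the Laurent polynomial \<open>f\<close> in \<open>\<surd>t\<close>: writing
  \<open>f = p(\<surd>t) / (\<surd>t)\<^sup>k\<close>, the numerator \<open>p\<close> vanishes at a square root \<open>w\<close> of \<open>z\<close>. As \<open>w \<noteq> 0\<close>, this does
  not depend on the choice of \<open>p\<close> and \<open>k\<close>; if \<open>f\<close> is a Laurent polynomial in \<open>t\<close>, possibly times \<open>\<surd>t\<close>,
  it does not depend on the choice of \<open>w\<close> either.
\<close>

definition laurent_zero :: "int poly fract \<Rightarrow> complex \<Rightarrow> bool" where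
  "laurent_zero f z \<longleftrightarrow> z \<noteq> 0 \<and>
     (\<exists>(p :: int poly) k w. f = poly (map_poly of_int p) sqrt_t / sqrt_t ^ k \<and>
        w ^ 2 = z \<and> poly (map_poly of_int p) w = 0)"

text \<open>
  The quotient in the formula is always a Laurent polynomial in \<open>\<surd>t\<close>: modulo \<open>1 + t + t\<^sup>2\<close>, every
  matrix in the image of the Burau representation fixes the vector \<open>(1, 1 + t)\<close>.
\<close>

lemma of_int_fract: "(of_int c :: int poly fract) = to_fract [:c:]"
proof -
  have nat: "(of_nat n :: int poly fract) = to_fract (of_nat n)" for n
    by (induction n) simp_all
  show ?thesis
    by (cases c rule: int_cases2) (simp_all add: nat of_nat_poly flip: to_fract_uminus)
qed

lemma poly_sqrt_t: "poly (map_poly of_int p) sqrt_t = to_fract p"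
proof (induction p)
  case (pCons a p)
  have "to_fract (pCons a p) = to_fract ([:a:] + [:0, 1:] * p)"
    by simp
  also have "\<dots> = of_int a + sqrt_t * to_fract p"
    by (simp only: to_fract_add to_fract_mult of_int_fract sqrt_t_def)
  finally show ?case
    using pCons by (simp add: map_poly_pCons)
qed simp

lemma to_fract_power: "to_fract (p ^ k) = to_fract p ^ k"
  by (induction k) simp_all

lemma laurent_polys_sqrt_t_iff:
  "f \<in> laurent_polys sqrt_t \<longleftrightarrow> (\<exists>p k. f = to_fract p / sqrt_t ^ k)"
  by (auto simp: laurent_polys_def poly_sqrt_t)

lemma laurent_to_fract: "to_fract p \<in> laurent_polys sqrt_t"
  unfolding laurent_polys_sqrt_t_iff by (rule exI[of _ p], rule exI[of _ 0]) simp

lemma laurent_one: "1 \<in> laurent_polys sqrt_t" and laurent_zero_mem: "0 \<in> laurent_polys sqrt_t"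
  using laurent_to_fract[of 1] laurent_to_fract[of 0] by simp_all

lemma laurent_mult:
  assumes "f \<in> laurent_polys sqrt_t" "g \<in> laurent_polys sqrt_t"
  shows "f * g \<in> laurent_polys sqrt_t"
proof -
  obtain p k q l where "f = to_fract p / sqrt_t ^ k" "g = to_fract q / sqrt_t ^ l"
    using assms by (auto simp: laurent_polys_sqrt_t_iff)
  then have "f * g = to_fract (p * q) / sqrt_t ^ (k + l)"
    by (simp add: power_add)
  then show ?thesis unfolding laurent_polys_sqrt_t_iff by blast
qed

lemma laurent_uminus: "f \<in> laurent_polys sqrt_t \<Longrightarrow> - f \<in> laurent_polys sqrt_t"
  using laurent_mult[OF laurent_to_fract[of "- 1"]] by simp

lemma laurent_add:
  assumes "f \<in> laurent_polys sqrt_t" "g \<in> laurent_polys sqrt_t"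
  shows "f + g \<in> laurent_polys sqrt_t"
proof -
  obtain p k q l where "f = to_fract p / sqrt_t ^ k" "g = to_fract q / sqrt_t ^ l"
    using assms by (auto simp: laurent_polys_sqrt_t_iff)
  then have "f + g = to_fract (p * [:0, 1:] ^ l + q * [:0, 1:] ^ k) / sqrt_t ^ (k + l)"
    using sqrt_t_neq_0
    by (simp add: to_fract_power power_add add_divide_distrib mult.commute flip: sqrt_t_def)
  then show ?thesis unfolding laurent_polys_sqrt_t_iff by blast
qed

lemma laurent_diff:
  "f \<in> laurent_polys sqrt_t \<Longrightarrow> g \<in> laurent_polys sqrt_t \<Longrightarrow> f - g \<in> laurent_polys sqrt_t"
  using laurent_add[of f "- g"] laurent_uminus[of g] by simp

lemma laurent_sqrt_t: "sqrt_t \<in> laurent_polys sqrt_t"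
  unfolding sqrt_t_def by (rule laurent_to_fract[unfolded sqrt_t_def])

lemma laurent_inv_sqrt_t: "1 / sqrt_t \<in> laurent_polys sqrt_t"
  unfolding laurent_polys_sqrt_t_iff by (rule exI[of _ 1], rule exI[of _ 1]) simp

lemma laurent_power: "f \<in> laurent_polys sqrt_t \<Longrightarrow> f ^ k \<in> laurent_polys sqrt_t"
  by (induction k) (auto intro: laurent_mult laurent_one)

lemma laurent_t: "t \<in> laurent_polys sqrt_t"
  unfolding t_def by (intro laurent_power laurent_sqrt_t)

lemma laurent_inv_t: "1 / t \<in> laurent_polys sqrt_t"
  using laurent_power[OF laurent_inv_sqrt_t, of 2] by (simp add: t_def power_divide)

lemmas laurent_intros = laurent_one laurent_zero_mem laurent_mult laurent_uminus laurent_add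
  laurent_diff laurent_t laurent_inv_t

lemma matrix_inv_unique:
  assumes "A ** B = mat 1" "B ** A = mat (1 :: 'a :: comm_ring_1)"
  shows "matrix_inv A = B"
proof -
  have "\<exists>C. A ** C = mat 1 \<and> C ** A = mat 1" using assms by blast
  from someI_ex[OF this] have "matrix_inv A ** A = mat 1" by (simp add: matrix_inv_def)
  then have "matrix_inv A ** (A ** B) = B" by (simp add: matrix_mul_assoc)
  then show ?thesis by (simp add: assms)
qed

lemma burau_letter_inverse:
  "burau_letter (S1, False) = vector [vector [- 1 / t, 1 / t], vector [0, 1]]"
  "burau_letter (S2, False) = vector [vector [1, 0], vector [1, - 1 / t]]"
  using t_neq_0 by (simp_all, intro matrix_inv_unique;
      simp add: matrix_matrix_mult_def vec_eq_iff forall_2 sum_2 mat_def)+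

lemma burau_word_mod:
  "(\<forall>i j. burau_word w $ i $ j \<in> laurent_polys sqrt_t) \<and>
   (\<exists>x y. x \<in> laurent_polys sqrt_t \<and> y \<in> laurent_polys sqrt_t \<and>
      burau_word w $ 1 $ 1 + burau_word w $ 1 $ 2 * (1 + t) = 1 + (1 + t + t ^ 2) * x \<and>
      burau_word w $ 2 $ 1 + burau_word w $ 2 $ 2 * (1 + t) = 1 + t + (1 + t + t ^ 2) * y)"
proof (induction w)
  case Nil
  show ?case
    by (auto simp: burau_word_def mat_def laurent_intros intro!: exI[of _ 0])
next
  case (Cons a w)
  define M where "M = burau_word w"
  define L where "L = burau_letter a"
  have LM: "burau_word (a # w) = L ** M"
    by (simp add: burau_word_def L_def M_def)
  have entry: "(L ** M) $ i $ j = L $ i $ 1 * M $ 1 $ j + L $ i $ 2 * M $ 2 $ j" for i j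
    by (simp add: matrix_matrix_mult_def sum_2)
  from Cons obtain x y where IH: "\<And>i j. M $ i $ j \<in> laurent_polys sqrt_t"
    "x \<in> laurent_polys sqrt_t" "y \<in> laurent_polys sqrt_t"
    "M $ 1 $ 1 + M $ 1 $ 2 * (1 + t) = 1 + (1 + t + t ^ 2) * x"
    "M $ 2 $ 1 + M $ 2 $ 2 * (1 + t) = 1 + t + (1 + t + t ^ 2) * y"
    unfolding M_def by blast
  obtain g e where a: "a = (g, e)" by (cases a)
  have Lint: "L $ i $ j \<in> laurent_polys sqrt_t" for i j
    unfolding L_def a using exhaust_2[of i] exhaust_2[of j] laurent_uminus[OF laurent_inv_t]
    by (cases g; cases e) (auto simp: burau_letter_inverse laurent_intros
        simp del: burau_letter.simps simp: burau_letter.simps[of _ True])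
  have "\<exists>c. c \<in> laurent_polys sqrt_t \<and> L $ 1 $ 1 + L $ 1 $ 2 * (1 + t) = 1 \<and>
      L $ 2 $ 1 + L $ 2 $ 2 * (1 + t) = 1 + t + (1 + t + t ^ 2) * c"
  proof (cases g; cases e)
    assume "g = S1" "e"
    then show ?thesis by (auto simp: L_def a laurent_intros intro!: exI[of _ 0])
  next
    assume "g = S1" "\<not> e"
    then show ?thesis using t_neq_0
      by (auto simp: L_def a burau_letter_inverse laurent_intros field_simps
          simp del: burau_letter.simps intro!: exI[of _ 0])
  next
    assume "g = S2" "e"
    then show ?thesis
      by (auto simp: L_def a laurent_intros algebra_simps power2_eq_square intro!: exI[of _ "- 1"])
  next
    assume "g = S2" "\<not> e"
    then show ?thesis using t_neq_0 laurent_uminus[OF laurent_inv_t]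
      by (auto simp: L_def a burau_letter_inverse laurent_intros field_simps power2_eq_square
          simp del: burau_letter.simps intro!: exI[of _ "- (1 / t)"])
  qed
  then obtain c where c: "c \<in> laurent_polys sqrt_t" "L $ 1 $ 1 + L $ 1 $ 2 * (1 + t) = 1"
    "L $ 2 $ 1 + L $ 2 $ 2 * (1 + t) = 1 + t + (1 + t + t ^ 2) * c"
    by blast
  have step: "(L ** M) $ i $ 1 + (L ** M) $ i $ 2 * (1 + t) =
      (L $ i $ 1 + L $ i $ 2 * (1 + t)) + (1 + t + t ^ 2) * (L $ i $ 1 * x + L $ i $ 2 * y)" for i
  proof -
    have "(L ** M) $ i $ 1 + (L ** M) $ i $ 2 * (1 + t) =
        L $ i $ 1 * (M $ 1 $ 1 + M $ 1 $ 2 * (1 + t)) + L $ i $ 2 * (M $ 2 $ 1 + M $ 2 $ 2 * (1 + t))"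
      by (simp add: entry algebra_simps)
    also have "\<dots> = (L $ i $ 1 + L $ i $ 2 * (1 + t)) +
        (1 + t + t ^ 2) * (L $ i $ 1 * x + L $ i $ 2 * y)"
      unfolding IH(4,5) by (simp add: algebra_simps)
    finally show ?thesis .
  qed
  show ?case
    unfolding LM
  proof (intro conjI allI exI)
    show "(L ** M) $ i $ j \<in> laurent_polys sqrt_t" for i j
      unfolding entry by (intro laurent_intros Lint IH)
    show "L $ 1 $ 1 * x + L $ 1 $ 2 * y \<in> laurent_polys sqrt_t"
      "c + (L $ 2 $ 1 * x + L $ 2 $ 2 * y) \<in> laurent_polys sqrt_t"
      by (intro laurent_intros Lint IH c)+
  qed (unfold step c, simp_all add: algebra_simps)
qed

lemma one_minus_t_neq_0: "1 - t \<noteq> 0" and one_plus_t_neq_0: "1 + t + t ^ 2 \<noteq> 0"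
proof -
  have "to_fract (1 - [:0, 1:] ^ 2 :: int poly) \<noteq> 0"
    "to_fract (1 + [:0, 1:] ^ 2 + ([:0, 1:] ^ 2) ^ 2 :: int poly) \<noteq> 0"
    unfolding to_fract_eq_0_iff by (simp_all add: power2_eq_square one_pCons)
  then show "1 - t \<noteq> 0" "1 + t + t ^ 2 \<noteq> 0"
    by (simp_all add: to_fract_power t_def sqrt_t_def)
qed

theorem alexander_formula_laurent: "alexander_formula b \<in> laurent_polys sqrt_t"
proof -
  obtain w where w: "burau b = burau_word w"
    by transfer blast
  define M where "M = burau b"
  obtain x y where M: "\<And>i j. M $ i $ j \<in> laurent_polys sqrt_t"
    "x \<in> laurent_polys sqrt_t" "y \<in> laurent_polys sqrt_t"
    "M $ 1 $ 1 + M $ 1 $ 2 * (1 + t) = 1 + (1 + t + t ^ 2) * x"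
    "M $ 2 $ 1 + M $ 2 $ 2 * (1 + t) = 1 + t + (1 + t + t ^ 2) * y"
    using burau_word_mod[of w] unfolding M_def w by blast
  have M': "M $ 1 $ 1 = 1 + (1 + t + t ^ 2) * x - M $ 1 $ 2 * (1 + t)"
    "M $ 2 $ 1 = 1 + t + (1 + t + t ^ 2) * y - M $ 2 $ 2 * (1 + t)"
    using M(4,5) by (simp_all add: algebra_simps)
  have det: "det (mat 1 - M) = (1 + t + t ^ 2) * (- x * (1 - M $ 2 $ 2) - M $ 1 $ 2 * y)"
    by (simp add: det_2 mat_def M') (simp add: algebra_simps)
  have "1 - t ^ 3 = (1 - t) * (1 + t + t ^ 2)"
    by (simp add: algebra_simps power2_eq_square power3_eq_cube)
  then have "(1 - t) / (1 - t ^ 3) * det (mat 1 - M) = - x * (1 - M $ 2 $ 2) - M $ 1 $ 2 * y"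
    using one_minus_t_neq_0 one_plus_t_neq_0 by (simp add: det)
  then have "alexander_formula b =
      (- 1 / sqrt_t) powi (exponent_sum b - 2) * (- x * (1 - M $ 2 $ 2) - M $ 1 $ 2 * y)"
    by (simp only: alexander_formula_def mult.assoc M_def)
  moreover have "(- 1 / sqrt_t) powi m \<in> laurent_polys sqrt_t" for m
    using laurent_power[OF laurent_uminus[OF laurent_sqrt_t]]
      laurent_power[OF laurent_uminus[OF laurent_inv_sqrt_t]]
    by (auto simp: power_int_def)
  ultimately show ?thesis
    by (auto intro!: laurent_intros M)
qed

end

theory Submission
  imports Defs
begin

text \<open>
  The matrix \<open>A\<close> of \<open>\<sigma>\<^sub>1 \<sigma>\<^sub>2\<^sup>-\<^sup>1\<close> has determinant \<open>1\<close> and trace \<open>1 - t - 1 / t\<close>, so that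
  \<open>det (I - A\<^sup>n) = 2 - tr (A\<^sup>n)\<close>. At a zero \<open>z\<close> an eigenvalue \<open>\<lambda>\<close> of \<open>A\<close> satisfies
  \<open>\<lambda>\<^sup>n + \<lambda>\<^sup>-\<^sup>n = 2\<close>, hence \<open>\<lambda>\<^sup>n = 1\<close>, and \<open>z + 1 / z = 1 - 2 Re \<lambda>\<close> is real and at least \<open>- 1\<close>.
  The zeros of the factor \<open>1 + t + t\<^sup>2\<close> (the case \<open>\<lambda> = 1\<close>) also satisfy the conclusion, so
  it does not have to be divided out.
\<close>

section \<open>Evaluation of Laurent polynomials\<close>

text \<open>Together with the next two lemmas: integer polynomials evaluate at \<open>w\<close> by a
  ring homomorphism.\<close>

lemma poly_of_int_add:
  "poly (map_poly of_int (p + q)) w =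
     poly (map_poly of_int p) w + poly (map_poly of_int q) (w :: 'a :: comm_ring_1)"
  by (induction p q rule: poly_induct2) (simp_all add: map_poly_pCons algebra_simps)

lemma poly_of_int_smult:
  "poly (map_poly of_int (smult a p)) w = of_int a * poly (map_poly of_int p) (w :: 'a :: comm_ring_1)"
  by (induction p) (simp_all add: map_poly_pCons algebra_simps)

lemma poly_of_int_mult:
  "poly (map_poly of_int (p * q)) w =
     poly (map_poly of_int p) w * poly (map_poly of_int q) (w :: 'a :: comm_ring_1)"
  by (induction p)
    (simp_all add: map_poly_pCons poly_of_int_add poly_of_int_smult algebra_simps)

text \<open>For \<open>w \<noteq> 0\<close> this is the graph of the ring homomorphism from Laurent
  polynomials in \<open>sqrt_t\<close> to the complex numbers that sends \<open>sqrt_t\<close> to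
  \<open>w\<close>. A relation avoids choosing \<open>p\<close> and \<open>k\<close>.\<close>

definition laurent_eval :: "complex \<Rightarrow> int poly fract \<Rightarrow> complex \<Rightarrow> bool" where
  "laurent_eval w f c \<longleftrightarrow>
     (\<exists>p k. f * sqrt_t ^ k = to_fract p \<and> c * w ^ k = poly (map_poly of_int p) w)"

lemma laurent_evalI:
  "f * sqrt_t ^ k = to_fract p \<Longrightarrow> c * w ^ k = poly (map_poly of_int p) w \<Longrightarrow> laurent_eval w f c"
  unfolding laurent_eval_def by blast

lemma sqrt_t_power: "sqrt_t ^ k = to_fract ([:0, 1:] ^ k)"
  by (simp add: to_fract_power sqrt_t_def)

lemma poly_of_int_X_power:
  "poly (map_poly of_int ([:0, 1:] ^ k)) w = (w :: 'a :: comm_ring_1) ^ k"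
  by (induction k) (simp_all add: poly_of_int_mult map_poly_pCons del: mult_pCons_left)

text \<open>Two representations of \<open>f\<close> cross-multiply to an identity in the polynomial
  ring; it is evaluated at \<open>w\<close>, and the powers of \<open>w \<noteq> 0\<close>
  cancel.\<close>

lemma laurent_eval_unique:
  assumes "laurent_eval w f c" "laurent_eval w f d" "w \<noteq> 0"
  shows "c = d"
proof -
  obtain p k q l where p: "f * sqrt_t ^ k = to_fract p" "c * w ^ k = poly (map_poly of_int p) w"
    and q: "f * sqrt_t ^ l = to_fract q" "d * w ^ l = poly (map_poly of_int q) w"
    using assms unfolding laurent_eval_def by blast
  have "to_fract (p * [:0, 1:] ^ l) = f * sqrt_t ^ k * sqrt_t ^ l"
    by (simp only: to_fract_mult flip: p(1) sqrt_t_power)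
  also have "\<dots> = f * sqrt_t ^ l * sqrt_t ^ k"
    by simp
  also have "\<dots> = to_fract (q * [:0, 1:] ^ k)"
    by (simp only: to_fract_mult flip: q(1) sqrt_t_power)
  finally have "p * [:0, 1:] ^ l = q * [:0, 1:] ^ k"
    by (simp only: to_fract_eq_iff)
  then have "poly (map_poly of_int (p * [:0, 1:] ^ l)) w = poly (map_poly of_int (q * [:0, 1:] ^ k)) w"
    by (simp only:)
  then have "c * (w ^ k * w ^ l) = d * (w ^ k * w ^ l)"
    by (simp only: poly_of_int_mult poly_of_int_X_power flip: p(2) q(2)) (simp add: mult_ac)
  then show ?thesis
    using assms(3) by simp
qed

lemma laurent_eval_add:
  assumes "laurent_eval w f c" "laurent_eval w g d"
  shows "laurent_eval w (f + g) (c + d)"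
proof -
  obtain p k q l where p: "f * sqrt_t ^ k = to_fract p" "c * w ^ k = poly (map_poly of_int p) w"
    and q: "g * sqrt_t ^ l = to_fract q" "d * w ^ l = poly (map_poly of_int q) w"
    using assms unfolding laurent_eval_def by blast
  show ?thesis
  proof (rule laurent_evalI)
    show "(f + g) * sqrt_t ^ (k + l) = to_fract (p * [:0, 1:] ^ l + q * [:0, 1:] ^ k)"
      by (simp only: to_fract_add to_fract_mult flip: sqrt_t_power p(1) q(1))
        (simp add: power_add algebra_simps)
    show "(c + d) * w ^ (k + l) = poly (map_poly of_int (p * [:0, 1:] ^ l + q * [:0, 1:] ^ k)) w"
      by (simp only: poly_of_int_add poly_of_int_mult poly_of_int_X_power flip: p(2) q(2))
        (simp add: power_add algebra_simps)
  qed
qed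

lemma laurent_eval_mult:
  assumes "laurent_eval w f c" "laurent_eval w g d"
  shows "laurent_eval w (f * g) (c * d)"
proof -
  obtain p k q l where p: "f * sqrt_t ^ k = to_fract p" "c * w ^ k = poly (map_poly of_int p) w"
    and q: "g * sqrt_t ^ l = to_fract q" "d * w ^ l = poly (map_poly of_int q) w"
    using assms unfolding laurent_eval_def by blast
  show ?thesis
  proof (rule laurent_evalI)
    show "(f * g) * sqrt_t ^ (k + l) = to_fract (p * q)"
      by (simp only: to_fract_mult flip: p(1) q(1)) (simp add: power_add mult_ac)
    show "(c * d) * w ^ (k + l) = poly (map_poly of_int (p * q)) w"
      by (simp only: poly_of_int_mult flip: p(2) q(2)) (simp add: power_add mult_ac)
  qed
qed

lemma laurent_eval_of_int: "laurent_eval w (of_int a) (of_int a)"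
  by (rule laurent_evalI[of _ 0 "[:a:]"]) (simp_all add: of_int_fract map_poly_pCons)

lemma laurent_eval_sqrt_t: "laurent_eval w sqrt_t w"
  by (rule laurent_evalI[of _ 0 "[:0, 1:]"]) (simp_all add: sqrt_t_def map_poly_pCons)

lemma laurent_eval_diff:
  assumes "laurent_eval w f c" "laurent_eval w g d"
  shows "laurent_eval w (f - g) (c - d)"
  using laurent_eval_add[OF assms(1) laurent_eval_mult[OF laurent_eval_of_int[of w "- 1"] assms(2)]]
  by simp

lemma laurent_eval_t: "laurent_eval w t (w ^ 2)"
  unfolding t_def power2_eq_square by (intro laurent_eval_mult laurent_eval_sqrt_t)

lemma laurent_eval_inv_t: "w \<noteq> 0 \<Longrightarrow> laurent_eval w (1 / t) (1 / w ^ 2)"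
  by (rule laurent_evalI[of _ 2 1]) (simp_all add: t_def sqrt_t_neq_0)

lemma laurent_eval_exists:
  assumes "f \<in> laurent_polys sqrt_t" "w \<noteq> 0"
  obtains c where "laurent_eval w f c"
proof -
  obtain p k where "f = to_fract p / sqrt_t ^ k"
    using assms(1) unfolding laurent_polys_sqrt_t_iff by blast
  then have "laurent_eval w f (poly (map_poly of_int p) w / w ^ k)"
    using assms(2) sqrt_t_neq_0 by (intro laurent_evalI[of _ k p]) simp_all
  then show ?thesis by (rule that)
qed

text \<open>Needed to evaluate units, which are Laurent polynomials in \<open>t\<close>, at a value
  of \<open>sqrt_t\<close>.\<close>

lemma laurent_polys_t_subset: "laurent_polys t \<subseteq> laurent_polys sqrt_t"
proof
  fix f assume "f \<in> laurent_polys t"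
  then obtain p k where f: "f = poly (map_poly of_int p) t / t ^ k"
    unfolding laurent_polys_def by blast
  have "poly (map_poly of_int p) t \<in> laurent_polys sqrt_t"
    by (induction p) (auto simp: map_poly_pCons of_int_fract laurent_to_fract intro!: laurent_intros)
  then have "poly (map_poly of_int p) t * (1 / t) ^ k \<in> laurent_polys sqrt_t"
    by (intro laurent_mult laurent_power laurent_inv_t)
  then show "f \<in> laurent_polys sqrt_t"
    by (simp add: f power_divide)
qed

lemma laurent_zero_eval:
  assumes "laurent_zero f z"
  obtains w where "w \<noteq> 0" "w ^ 2 = z" "laurent_eval w f 0"
proof -
  obtain p k w where "z \<noteq> 0" "f = poly (map_poly of_int p) sqrt_t / sqrt_t ^ k" "w ^ 2 = z"
    "poly (map_poly of_int p) w = 0"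
    using assms unfolding laurent_zero_def by blast
  then show ?thesis
    using sqrt_t_neq_0
    by (intro that[of w] laurent_evalI[of _ k p]) (auto simp: poly_sqrt_t)
qed

section \<open>The characteristic polynomial of the weaving braid\<close>

definition weaving_matrix :: "int poly fract ^ 2 ^ 2" where
  "weaving_matrix = vector [vector [1 - t, - 1 / t], vector [1, - 1 / t]]"

lemma burau_inverse_sigma2: "burau (inverse \<sigma>\<^sub>2) = vector [vector [1, 0], vector [1, - 1 / t]]"
proof -
  have "burau (inverse \<sigma>\<^sub>2) = burau_letter (S2, False)"
    by transfer (simp add: inv_word_def burau_word_def)
  then show ?thesis by (simp only: burau_letter_inverse)
qed

lemma burau_weaving_step: "burau (\<sigma>\<^sub>1 * inverse \<sigma>\<^sub>2) = weaving_matrix"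
  using t_neq_0
  by (simp add: burau_mult burau_sigma1 burau_inverse_sigma2 weaving_matrix_def
      matrix_matrix_mult_def vec_eq_iff forall_2 sum_2)

lemma burau_weaving_Suc: "burau (weaving_braid3 (Suc n)) = weaving_matrix ** burau (weaving_braid3 n)"
  by (simp add: weaving_braid3_def burau_mult flip: burau_weaving_step)

lemma det_burau_weaving: "det (burau (weaving_braid3 n)) = 1"
proof (induction n)
  case 0
  show ?case by (simp add: weaving_braid3_def burau_one)
next
  case (Suc n)
  have "det weaving_matrix = 1"
    using t_neq_0 by (simp add: weaving_matrix_def det_2 field_simps)
  with Suc show ?case by (simp add: burau_weaving_Suc det_mul)
qed

lemma trace_burau_weaving_0: "trace (burau (weaving_braid3 0)) = 2"
  by (simp add: weaving_braid3_def burau_one trace_def mat_def sum_2)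

lemma trace_burau_weaving_1: "trace (burau (weaving_braid3 1)) = 1 - t - 1 / t"
  by (simp add: weaving_braid3_def burau_weaving_step weaving_matrix_def trace_def sum_2)

text \<open>Cayley-Hamilton for a matrix \<open>A\<close> of determinant 1,
  \<open>A^2 = (tr A) A - I\<close>, multiplied by \<open>A^n\<close> and traced; checked here by
  expanding the entries.\<close>

lemma trace_burau_weaving_rec:
  "trace (burau (weaving_braid3 (Suc (Suc n)))) =
     (1 - t - 1 / t) * trace (burau (weaving_braid3 (Suc n))) - trace (burau (weaving_braid3 n))"
  using t_neq_0
  by (simp add: burau_weaving_Suc weaving_matrix_def trace_def sum_2 matrix_matrix_mult_def
      field_simps)

text \<open>The characteristic polynomial \<open>X^2 - (tr M) X + det M\<close> at
  \<open>X = 1\<close>.\<close>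

lemma det_one_minus_2:
  fixes M :: "'a :: comm_ring_1 ^ 2 ^ 2"
  shows "det (mat 1 - M) = 1 - trace M + det M"
  by (simp add: det_2 mat_def trace_def sum_2 algebra_simps)

lemma exponent_sum_weaving: "exponent_sum (weaving_braid3 n) = 0"
proof -
  have mult: "exponent_sum (a * b) = exponent_sum a + exponent_sum b" for a b
    by transfer (simp add: exp_sum_word_def)
  have "exponent_sum (\<sigma>\<^sub>1 * inverse \<sigma>\<^sub>2) = 0"
    by transfer (simp add: exp_sum_word_def inv_word_def)
  moreover have "exponent_sum 1 = 0"
    by transfer (simp add: exp_sum_word_def)
  ultimately show ?thesis
    by (induction n) (simp_all add: weaving_braid3_def mult)
qed

text \<open>Solved for the determinant, so that the cofactor of the formula is a Laurent polynomial
  and can be evaluated. Writing \<open>t * t\<close> lets \<open>laurent_intros\<close> apply, which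
  has no rule for powers.\<close>

lemma alexander_formula_weaving:
  "2 - trace (burau (weaving_braid3 n)) =
     (1 / t) * (1 + t + t * t) * alexander_formula (weaving_braid3 n)"
proof -
  define D where "D = det (mat 1 - burau (weaving_braid3 n))"
  have "(- 1 / sqrt_t) powi (- 2) = t"
    by (simp add: power_int_minus t_def power_divide)
  moreover have "1 - t ^ 3 = (1 - t) * (1 + t + t ^ 2)"
    by (simp add: algebra_simps power2_eq_square power3_eq_cube)
  ultimately have "alexander_formula (weaving_braid3 n) = t * D / (1 + t + t ^ 2)"
    using one_minus_t_neq_0 by (simp add: alexander_formula_def exponent_sum_weaving D_def)
  moreover have "D = 2 - trace (burau (weaving_braid3 n))"
    by (simp add: D_def det_one_minus_2 det_burau_weaving)
  ultimately show ?thesis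
    using t_neq_0 one_plus_t_neq_0 by (simp add: power2_eq_square)
qed

text \<open>At \<open>t = w^2\<close> the eigenvalues are \<open>l\<close> and \<open>1 / l\<close>.
  Instead of diagonalising, the induction uses that \<open>l^n + 1 / l^n\<close> obeys the
  recurrence of the traces.\<close>

lemma laurent_eval_trace_weaving:
  assumes "w \<noteq> 0" "l \<noteq> 0" "l + 1 / l = 1 - w ^ 2 - 1 / w ^ 2"
  shows "laurent_eval w (trace (burau (weaving_braid3 n))) (l ^ n + 1 / l ^ n)"
proof -
  have s: "laurent_eval w (1 - t - 1 / t) (l + 1 / l)"
    using laurent_eval_of_int[of w 1] assms(1) unfolding assms(3)
    by (intro laurent_eval_diff laurent_eval_t laurent_eval_inv_t) simp_all
  show ?thesis
  proof (induction n rule: induct_nat_012)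
    case 0
    show ?case using laurent_eval_of_int[of w 2] by (simp add: trace_burau_weaving_0)
  next
    case 1
    show ?case using s trace_burau_weaving_1 by simp
  next
    case (ge2 n)
    have "laurent_eval w (trace (burau (weaving_braid3 (Suc (Suc n)))))
        ((l + 1 / l) * (l ^ Suc n + 1 / l ^ Suc n) - (l ^ n + 1 / l ^ n))"
      unfolding trace_burau_weaving_rec by (intro laurent_eval_diff laurent_eval_mult s ge2)
    also have "(l + 1 / l) * (l ^ Suc n + 1 / l ^ Suc n) - (l ^ n + 1 / l ^ n) =
        l ^ Suc (Suc n) + 1 / l ^ Suc (Suc n)"
      using assms(2) by (simp add: field_simps)
    finally show ?case .
  qed
qed

section \<open>The zeros\<close>

text \<open>The quadratic formula gives a root \<open>l\<close> of \<open>X^2 - s X + 1\<close>; the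
  other root is \<open>s - l\<close>, and their product is 1.\<close>

lemma ex_plus_inverse_eq:
  fixes s :: complex
  obtains l where "l \<noteq> 0" "l + 1 / l = s"
proof -
  define l where "l = (s + csqrt (s ^ 2 - 4)) / 2"
  have "2 * l - s = csqrt (s ^ 2 - 4)"
    by (simp add: l_def add_divide_distrib)
  then have "(2 * l - s) ^ 2 = s ^ 2 - 4"
    by simp
  then have "l * (s - l) = 1"
    by (simp add: power2_eq_square algebra_simps) algebra
  moreover from this have "l \<noteq> 0"
    by auto
  ultimately have "l \<noteq> 0" "s - l = 1 / l"
    by (simp_all add: eq_divide_eq mult.commute)
  then show ?thesis
    by (intro that[of l]) (simp_all add: algebra_simps)
qed

text \<open>A negative real \<open>z\<close> would give \<open>z + 1 / z \<le> -2\<close>. For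
  non-real \<open>z\<close>, the imaginary part \<open>Im z (1 - 1 / |z|^2)\<close> vanishes only if
  \<open>|z| = 1\<close>; then \<open>2 Re z = c \<ge> -1\<close>.\<close>

lemma plus_inverse_real_ge_minus_one:
  fixes z :: complex
  assumes "z \<noteq> 0" "z + 1 / z = of_real c" "c \<ge> - 1"
  shows "Re z > - 1 \<and> (z \<notin> \<real> \<longrightarrow> cmod z = 1)"
proof (cases "z \<in> \<real>")
  case True
  then obtain x where x: "z = of_real x"
    by (auto elim: Reals_cases)
  then have "of_real (x + 1 / x) = (of_real c :: complex)"
    using assms(2) by simp
  then have c: "x + 1 / x = c"
    by (simp only: of_real_eq_iff)
  have "x > 0"
  proof (rule ccontr)
    assume "\<not> x > 0"
    with assms(1) x have "x < 0" by simp
    moreover have "x * x + 1 = c * x"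
      using c \<open>x < 0\<close> by (auto simp: field_simps)
    moreover have "c * x \<le> - x"
      using mult_right_mono_neg[OF assms(3), of x] \<open>x < 0\<close> by simp
    \<comment> \<open>The previous two facts give \<open>x^2 + x + 1 \<le> 0\<close>, hence
      \<open>(x + 1)^2 \<le> x < 0\<close>.\<close>
    moreover have "(x + 1) ^ 2 \<ge> 0" by simp
    ultimately show False
      by (simp add: power2_eq_square algebra_simps)
  qed
  then show ?thesis using x True by simp
next
  case False
  then have Im: "Im z \<noteq> 0"
    by (simp add: complex_is_Real_iff)
  have "Im (z + 1 / z) = 0" "Re (z + 1 / z) = c"
    by (simp_all add: assms(2))
  then have im: "Im z - Im z / ((Re z)\<^sup>2 + (Im z)\<^sup>2) = 0"
    and re: "Re z + Re z / ((Re z)\<^sup>2 + (Im z)\<^sup>2) = c"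
    by (simp_all add: Re_divide Im_divide)
  have "(Re z)\<^sup>2 + (Im z)\<^sup>2 \<noteq> 0"
    using Im by (simp add: sum_power2_eq_zero_iff)
  with im have "Im z * ((Re z)\<^sup>2 + (Im z)\<^sup>2) = Im z * 1"
    by (simp add: field_simps)
  with Im have 1: "(Re z)\<^sup>2 + (Im z)\<^sup>2 = 1"
    by (simp only: mult_cancel_left) simp
  with re assms(3) show ?thesis
    by (simp add: cmod_def)
qed

theorem corollary5p2:
  fixes n :: nat and \<Delta> :: "int poly fract" and z :: complex
  assumes "n \<ge> 1"
    and "alexander_polynomial_of_closure (weaving_braid3 n) \<Delta>"
    and "laurent_zero \<Delta> z"
  shows "Re z > - 1 \<and> (z \<notin> \<real> \<longrightarrow> cmod z = 1)"
proof -
  obtain w where w: "w \<noteq> 0" "w ^ 2 = z" "laurent_eval w \<Delta> 0"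
    using assms(3) by (rule laurent_zero_eval)
  obtain u v where "v \<in> laurent_polys t" "u * v = 1"
    and "\<Delta> = u * alexander_formula (weaving_braid3 n)"
    using assms(2) unfolding alexander_polynomial_of_closure_def laurent_unit_def by blast
  then have v: "v \<in> laurent_polys sqrt_t" and F: "alexander_formula (weaving_braid3 n) = v * \<Delta>"
    using laurent_polys_t_subset by (auto simp: mult.left_commute[of v u])
  \<comment> \<open>The cofactor of \<open>\<Delta>\<close> has some finite value \<open>d\<close>
    at \<open>w\<close>, so its product with \<open>\<Delta>\<close> evaluates to
    \<open>d * 0 = 0\<close>.\<close>
  have "(1 / t) * (1 + t + t * t) * v \<in> laurent_polys sqrt_t"
    by (intro laurent_intros v)
  then obtain d where "laurent_eval w ((1 / t) * (1 + t + t * t) * v) d"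
    using w(1) by (rule laurent_eval_exists)
  from laurent_eval_mult[OF this w(3)]
  have zero: "laurent_eval w (2 - trace (burau (weaving_braid3 n))) 0"
    by (simp add: alexander_formula_weaving F mult.assoc)
  obtain l where l: "l \<noteq> 0" "l + 1 / l = 1 - w ^ 2 - 1 / w ^ 2"
    by (rule ex_plus_inverse_eq)
  have "laurent_eval w (of_int 2 - trace (burau (weaving_braid3 n))) (of_int 2 - (l ^ n + 1 / l ^ n))"
    by (intro laurent_eval_diff laurent_eval_of_int laurent_eval_trace_weaving w(1) l)
  then have "2 - (l ^ n + 1 / l ^ n) = 0"
    by (intro laurent_eval_unique[OF _ zero w(1)]) simp
  \<comment> \<open>Multiply by \<open>- (l ^ n)\<close>.\<close>
  then have "(l ^ n - 1) ^ 2 = 0"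
    using l(1) by (simp add: field_simps power2_eq_square)
  then have "l ^ n = 1" by simp
  \<comment> \<open>As \<open>n \<ge> 1\<close>, \<open>l\<close> is a root of unity; its inverse is
    then its conjugate, which makes \<open>l + 1 / l\<close> real.\<close>
  then have norm: "cmod l = 1"
    using assms(1) power_eq_1_iff[of l n] by auto
  then have "1 / l = cnj l"
    using complex_norm_square[of l] l(1) by (simp add: field_simps)
  then have "l + 1 / l = of_real (2 * Re l)"
    by (simp add: complex_add_cnj)
  with l(2) w(2) have sum: "z + 1 / z = of_real (1 - 2 * Re l)"
    by (simp add: algebra_simps)
  have ge: "1 - 2 * Re l \<ge> - 1"
    using complex_Re_le_cmod[of l] norm by simp
  have "z \<noteq> 0"
    using w(1,2) by auto
  then show ?thesis
    using sum ge by (rule plus_inverse_real_ge_minus_one)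
qed

end
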